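(* As an identity of formal power series in $x,y,q$, $$\sum_{\Delta\in\mathcal{S}}x^{a(\Delta)}y^{b(\Delta)}q^{\frac{|\Delta|}{2}}=1+\sum_{i=0}^{\infty}x^i\sum_{k=1}^{\infty}\frac{(1+(y-1)q^k)\,y^{2k-1}q^{k(i+k)}}{(q;q)_k\,(q;q)_{i+k}}.$$
   Context: For integers $a\ge 0$ and $l\ge b\ge 1$, a finite sequence $\{d_1,\dots,d_l\}$ of $l$ positive integers is called an $(a,b)$-sequence of length $l$ if: (1) $d_1=a+1,\ d_2=a+2,\ \dots,\ d_b=a+b$; (2) $d_b\ge d_{b+1}\ge d_{b+2}\ge\cdots\ge d_l\ge 1$; (3) $\sum_{i=1}^{l}(-1)^i d_i=0$. $\mathcal{S}_{a,b}$ denotes the set of all $(a,b)$-sequences (of any length), and $\mathcal{S}=\left(\bigcup_{a\ge 0,\,b\ge 1}\mathcal{S}_{a,b}\right)\cup\{\epsilon\}$, where $\epsilon$ is the empty sequence. For $\Delta=\{d_1,\dots,d_l\}\in\mathcal{S}_{a,b}$, put $a(\Delta)=a$, $b(\Delta)=b$, $|\Delta|=\sum_{i=1}^l d_i$ (an even integer because of condition (3)). For the empty sequence, $a(\epsilon)=b(\epsilon)=|\epsilon|=0$. The $q$-shifted factorial is $(a;q)_k=\prod_{n=0}^{k-1}(1-aq^n)$, so $(q;q)_k=\prod_{n=1}^{k}(1-q^n)$. *)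

theory Defs
  imports "HOL-Analysis.Analysis"
begin

text \<open>Sequences are 0-indexed lists, so \<open>d\<^sub>i\<close> is \<open>ds ! (i - 1)\<close>.\<close>

definition ab_seq :: "nat \<Rightarrow> nat \<Rightarrow> nat list \<Rightarrow> bool" where
  "ab_seq a b ds \<longleftrightarrow>
     1 \<le> b \<and> b \<le> length ds \<and>
     (\<forall>i\<in>{1..length ds}. 1 \<le> ds ! (i - 1)) \<and>
     (\<forall>i\<in>{1..b}. ds ! (i - 1) = a + i) \<and>
     (\<forall>i\<in>{b..<length ds}. ds ! (i - 1) \<ge> ds ! i) \<and>
     (\<Sum>i=1..length ds. (- 1) ^ i * int (ds ! (i - 1))) = 0"

definition S_ab :: "nat \<Rightarrow> nat \<Rightarrow> nat list set" where
  "S_ab a b = {ds. ab_seq a b ds}"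

definition S_all :: "nat list set" where
  "S_all = (\<Union>a\<in>{0..}. \<Union>b\<in>{1..}. S_ab a b) \<union> {[]}"

definition a_of :: "nat list \<Rightarrow> nat" where
  "a_of ds = (if ds = [] then 0 else (THE a. \<exists>b. ds \<in> S_ab a b))"

definition b_of :: "nat list \<Rightarrow> nat" where
  "b_of ds = (if ds = [] then 0 else (THE b. \<exists>a. ds \<in> S_ab a b))"

lemma S_ab_unique:
  assumes "ds \<in> S_ab a b" "ds \<in> S_ab a' b'"
  shows "a = a'" "b = b'"
proof -
  have run: "ds ! (i - 1) = x + i" if "ds \<in> S_ab x y" "1 \<le> i" "i \<le> y" for x y i
    using that unfolding S_ab_def ab_seq_def by auto
  have pos: "1 \<le> b" "1 \<le> b'" using assms by (auto simp: S_ab_def ab_seq_def)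
  show a: "a = a'" using run[OF assms(1), of 1] run[OF assms(2), of 1] pos by simp
  have le: "y' \<le> y" if "ds \<in> S_ab x y" "ds \<in> S_ab x y'" for x y y'
  proof (rule ccontr)
    assume "\<not> y' \<le> y"
    hence less: "y < y'" by simp
    have y: "1 \<le> y" "y < length ds"
      using that less by (auto simp: S_ab_def ab_seq_def)
    have "\<forall>i\<in>{y..<length ds}. ds ! (i - 1) \<ge> ds ! i"
      using that(1) unfolding S_ab_def ab_seq_def by blast
    hence "ds ! (y - 1) \<ge> ds ! y" using y by simp
    moreover have "ds ! (y - 1) = x + y" using run[OF that(1), of y] y by simp
    moreover have "ds ! y = x + Suc y" using run[OF that(2), of "Suc y"] less by simp
    ultimately show False by simp
  qed
  show "b = b'" using le[of a b b'] le[of a b' b] assms a by simp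
qed

lemma a_of_eq: "ds \<in> S_ab a b \<Longrightarrow> a_of ds = a"
  and b_of_eq: "ds \<in> S_ab a b \<Longrightarrow> b_of ds = b"
proof -
  assume ds: "ds \<in> S_ab a b"
  hence "ds \<noteq> []" by (auto simp: S_ab_def ab_seq_def)
  moreover have "(THE a. \<exists>b. ds \<in> S_ab a b) = a" "(THE b. \<exists>a. ds \<in> S_ab a b) = b"
    using ds S_ab_unique[OF ds] by (blast intro: the_equality)+
  ultimately show "a_of ds = a" "b_of ds = b"
    by (simp_all only: a_of_def b_of_def if_False)
qed

lemma even_sum_list_S_all:
  assumes "ds \<in> S_all"
  shows "even (sum_list ds)"
proof (cases "ds = []")
  case False
  with assms have alt: "(\<Sum>i=1..length ds. (- 1) ^ i * int (ds ! (i - 1))) = 0"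
    by (auto simp: S_all_def S_ab_def ab_seq_def)
  have "int (sum_list ds) = (\<Sum>i=1..length ds. int (ds ! (i - 1)))"
    by (simp add: sum_list_sum_nth sum.atLeast1_atMost_eq atLeast0LessThan)
  also have "\<dots> = (\<Sum>i=1..length ds. int (ds ! (i - 1)) - (- 1) ^ i * int (ds ! (i - 1)))"
    by (simp only: sum_subtractf alt diff_0_right)
  also have "even \<dots>"
    by (rule dvd_sum) simp
  finally show ?thesis by simp
qed simp

definition qpoch :: "'a::comm_ring_1 \<Rightarrow> 'a \<Rightarrow> nat \<Rightarrow> 'a" where
  "qpoch a q k = (\<Prod>n<k. 1 - a * q ^ n)"

text \<open>
  The ring of formal power series in \<open>x, y, q\<close> is rendered as the iterated ring
  \<open>\<rat>[[x]][[y]][[q]]\<close>. Infinite sums in it are taken in the library's metric, i.e. in the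
  \<open>q\<close>-adic topology. It is finer than the topology of coefficientwise convergence in
  \<open>x, y, q\<close>, so a sum that exists here is also the sum of the series in the usual sense.
\<close>

type_synonym fps_xyq = "rat fps fps fps"

definition var_q :: fps_xyq where "var_q = fps_X"
definition var_y :: fps_xyq where "var_y = fps_const fps_X"
definition var_x :: fps_xyq where "var_x = fps_const (fps_const fps_X)"

text \<open>
  The coefficients of the powers of \<open>q\<close> do not form a field, so division is only meaningful
  for suitable divisors. The next facts show that division by a product of \<open>q\<close>-shifted
  factorials is multiplication by a genuine inverse.
\<close>

lemma qpoch_nth_0: "fps_nth (qpoch var_q var_q k) 0 = 1"
proof (induction k)
  case (Suc k)
  have "qpoch var_q var_q (Suc k) = qpoch var_q var_q k * (1 - var_q * var_q ^ k)"
    by (simp only: qpoch_def prod.lessThan_Suc)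
  thus ?case by (simp only: Suc fps_mult_nth_0 fps_sub_nth) (simp add: var_q_def)
qed (simp add: qpoch_def)

lemma divide_fps_xyq:
  fixes f D :: fps_xyq
  assumes "fps_nth D 0 = 1"
  shows "D * inverse D = 1" "f / D = f * inverse D"
proof -
  have "inverse (1 :: rat fps fps) = 1"
    by (rule fps_inverse_one'[OF fps_inverse_one])
  thus "D * inverse D = 1"
    unfolding fps_inverse_def using assms by (intro fps_right_inverse) simp
  have "subdegree D = 0" using assms by (intro subdegreeI) auto
  thus "f / D = f * inverse D" by (simp add: fps_divide_def)
qed

lemma divide_qpoch:
  fixes f :: fps_xyq
  defines "D \<equiv> \<lambda>k m. qpoch var_q var_q k * qpoch var_q var_q m"
  shows "D k m * inverse (D k m) = 1" "f / D k m = f * inverse (D k m)"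
proof -
  have "fps_nth (D k m) 0 = 1"
    by (simp only: D_def fps_mult_nth_0 qpoch_nth_0 mult_1)
  thus "D k m * inverse (D k m) = 1" "f / D k m = f * inverse (D k m)"
    by (rule divide_fps_xyq)+
qed

end

theory Submission
  imports Defs
begin

text \<open>
  An \<open>(a, b)\<close>-sequence is the run \<open>a + 1, \<dots>, a + b\<close> followed by a tail, which is a partition
  with parts at most \<open>N = a + b\<close>. The alternating sum of the run depends only on \<open>a\<close> and \<open>b\<close>, so
  the vanishing condition prescribes the alternating sum \<open>s\<close> of the tail:
  \<open>s = k\<close> if \<open>b = 2 k\<close>, and \<open>s = a + k\<close> if \<open>b = 2 k - 1\<close>.

  Everything rests on the generating function of such tails. Drawn as a Ferrers diagram, a tail has
  \<open>N\<close> columns (some possibly empty), and its alternating sum is the number of columns of odd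
  height. A multiset of \<open>N\<close> column heights is a free choice of \<open>s\<close> odd and \<open>N - s\<close> even numbers, so the
  tails \<open>e\<close> weighted by \<open>q\<close> to the power \<open>(|e| - s) / 2\<close> have the generating function
  \<open>U N s = 1 / ((q;q)\<^sub>s (q;q)\<^sub>N\<^sub>-\<^sub>s)\<close>. In the lemma \<open>qpoch_tails_fps\<close> this is obtained without conjugate
  partitions: removing a largest part equal to \<open>N\<close> turns the alternating sum \<open>s\<close> into \<open>N - s\<close>, so
  \<open>U N s = U (N - 1) s + q\<^bsup>N - s\<^esup> U N (N - s)\<close>, and this recurrence has the product as its solution.

  The run and the tail together have half weight \<open>k (a + k) + k\<close> plus the exponent in \<open>U\<close> if
  \<open>b = 2 k\<close>, and \<open>k (a + k)\<close> plus that exponent if \<open>b = 2 k - 1\<close> (lemmas \<open>count_S_even\<close> and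
  \<open>count_S_odd\<close>). These two values of \<open>b\<close> share the denominator \<open>(q;q)\<^sub>k (q;q)\<^sub>a\<^sub>+\<^sub>k\<close> if the odd one is
  expanded by \<open>1 - q\<^sup>k\<close>; together they give
  \<open>y\<^bsup>2 k - 1\<^esup>\<close> times the factor \<open>(1 - q\<^sup>k) + y q\<^sup>k = 1 + (y - 1) q\<^sup>k\<close> of the theorem (lemma \<open>rhs_term_eq\<close>).

  For the infinite sums, only finitely many terms contribute to a given power of \<open>q\<close>, since \<open>a\<close>, \<open>b\<close>
  and all entries of a sequence are bounded by its weight. So all sums converge, and the identity
  can be checked on the coefficients of the powers of \<open>q\<close>.
\<close>

section \<open>Sums of formal power series in the X-adic topology\<close>

text \<open>
  Convergence in the metric of formal power series is eventual constancy of every coefficient. The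
  finite sets \<open>F n\<close> may differ from coefficient to coefficient and need not be the exact supports,
  so that convenient intervals can be used for them.
\<close>

lemma has_sum_fpsI:
  fixes f :: "'i \<Rightarrow> 'a::comm_ring_1 fps"
  assumes fin: "\<And>n. finite (F n)" and sub: "\<And>n. F n \<subseteq> A"
    and zero: "\<And>n a. a \<in> A \<Longrightarrow> a \<notin> F n \<Longrightarrow> fps_nth (f a) n = 0"
    and nth: "\<And>n. fps_nth S n = (\<Sum>a\<in>F n. fps_nth (f a) n)"
  shows "(f has_sum S) A"
  unfolding has_sum_def
proof (rule tendsto_fpsI)
  fix n
  have "fps_nth (sum f B) n = fps_nth S n" if "finite B" "F n \<subseteq> B" "B \<subseteq> A" for B
    unfolding fps_sum_nth nth using that zero by (intro sum.mono_neutral_right) auto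
  thus "\<forall>\<^sub>F B in finite_subsets_at_top A. fps_nth (sum f B) n = fps_nth S n"
    unfolding eventually_finite_subsets_at_top
    by (intro exI[of _ "F n"] conjI fin sub allI impI) (elim conjE)
qed

section \<open>Alternating sums\<close>

text \<open>
  The first entry is counted positively, so that the alternating sum of a partition is nonnegative;
  this is the opposite of the sign in the definition of an \<open>(a, b)\<close>-sequence.
\<close>

fun altsum :: "nat list \<Rightarrow> int" where
  "altsum [] = 0"
| "altsum (x # xs) = int x - altsum xs"

lemma altsum_append: "altsum (xs @ ys) = altsum xs + (- 1) ^ length xs * altsum ys"
  by (induction xs) auto

lemma altsum_conv_sum: "(\<Sum>i=1..length ds. (- 1) ^ i * int (ds ! (i - 1))) = - altsum ds"
proof (induction ds rule: rev_induct)
  case (snoc d ds)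
  have "(\<Sum>i=1..length ds. (- 1) ^ i * int ((ds @ [d]) ! (i - 1)))
      = (\<Sum>i=1..length ds. (- 1) ^ i * int (ds ! (i - 1)))"
    by (intro sum.cong) (auto simp: nth_append)
  thus ?case using snoc by (simp add: altsum_append)
qed simp

lemma altsum_le_sum_list: "\<bar>altsum ds\<bar> \<le> int (sum_list ds)"
  by (induction ds) auto

text \<open>
  The induction is over shorter lists and smaller bounds: the rest of a descending list is bounded
  by its first entry \<open>d\<close>, and \<open>s \<mapsto> d - s\<close> maps the interval from \<open>0\<close> to \<open>d\<close> to itself.
\<close>

lemma altsum_bounds:
  assumes "sorted_wrt (\<ge>) ds" "set ds \<subseteq> {..N}"
  shows "0 \<le> altsum ds \<and> altsum ds \<le> int N"
  using assms
proof (induction ds arbitrary: N)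
  case (Cons d ds)
  from Cons.prems have "0 \<le> altsum ds \<and> altsum ds \<le> int d"
    by (intro Cons.IH) auto
  thus ?case using Cons.prems by auto
qed simp

lemma altsum_even_run: "altsum [a + 1..<a + 1 + 2 * k] = - int k"
proof (induction k)
  case (Suc k)
  have "[a + 1..<a + 1 + 2 * Suc k] = [a + 1..<a + 1 + 2 * k] @ [a + 1 + 2 * k, a + 2 + 2 * k]"
    by simp
  hence "altsum [a + 1..<a + 1 + 2 * Suc k] = altsum [a + 1..<a + 1 + 2 * k] - 1"
    by (simp only: altsum_append length_upt) simp
  thus ?case by (simp only: Suc.IH of_nat_Suc)
qed simp

lemma altsum_odd_run: "altsum [a + 1..<a + 2 + 2 * k] = int (a + k + 1)"
proof -
  have "[a + 1..<a + 2 + 2 * k] = [a + 1..<a + 1 + 2 * k] @ [a + 1 + 2 * k]"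
    by simp
  thus ?thesis by (simp only: altsum_append altsum_even_run length_upt) simp
qed

section \<open>Partitions with bounded parts and prescribed alternating sum\<close>

text \<open>
  These are the possible tails with their weight normalised. The sum of a list has the same parity
  as its alternating sum and is at least as large, so a partition of alternating sum \<open>s\<close> has weight
  \<open>s + 2 h\<close> for some \<open>h\<close>. Recording \<open>h\<close> instead of the weight avoids half-integral exponents of
  \<open>q\<close>.
\<close>

definition tails :: "nat \<Rightarrow> nat \<Rightarrow> nat \<Rightarrow> nat list set" where
  "tails N s h = {e. set e \<subseteq> {1..N} \<and> sorted_wrt (\<ge>) e \<and> altsum e = int s \<and>
                     sum_list e = s + 2 * h}"

definition tails_fps :: "nat \<Rightarrow> nat \<Rightarrow> 'a::comm_ring_1 fps" where
  "tails_fps N s = Abs_fps (\<lambda>h. of_nat (card (tails N s h)))"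

lemma length_le_sum_list: "0 \<notin> set ds \<Longrightarrow> length ds \<le> sum_list (ds :: nat list)"
  by (induction ds) auto

lemma finite_positive_lists_sum: "finite {ds :: nat list. 0 \<notin> set ds \<and> sum_list ds = n}"
proof (rule finite_subset)
  show "{ds :: nat list. 0 \<notin> set ds \<and> sum_list ds = n} \<subseteq> {ds. set ds \<subseteq> {..n} \<and> length ds \<le> n}"
    using length_le_sum_list by (auto intro: member_le_sum_list)
  show "finite {ds. set ds \<subseteq> {..n} \<and> length ds \<le> n}"
    by (rule finite_lists_length_le) simp
qed

lemma finite_tails: "finite (tails N s h)"
  by (rule finite_subset[OF _ finite_positive_lists_sum[of "s + 2 * h"]])
     (auto simp: tails_def)

lemma tails_empty:
  assumes "N < s"
  shows "tails N s h = {}"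
proof -
  have "altsum e \<le> int N" if "e \<in> tails N s h" for e
    using altsum_bounds[of e N] that by (force simp: tails_def)
  thus ?thesis using assms by (fastforce simp: tails_def)
qed

text \<open>
  A tail with parts at most \<open>N + 1\<close> either has no part \<open>N + 1\<close> or starts with one. Removing it replaces
  the alternating sum \<open>s\<close> by \<open>N + 1 - s\<close>; comparing weights,
  \<open>s + 2 h - (N + 1) = (N + 1 - s) + 2 (h - (N + 1 - s))\<close>.
  The subtraction from \<open>h\<close> is never truncated for an actual tail, since the weight of what remains is
  at least its alternating sum.
\<close>

lemma tails_rec:
  assumes "s \<le> Suc N"
  shows "tails (Suc N) s h =
    tails N s h \<union> (if Suc N - s \<le> h then (#) (Suc N) ` tails (Suc N) (Suc N - s) (h - (Suc N - s)) else {})"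
    (is "_ = _ \<union> ?B")
proof (intro equalityI subsetI)
  fix e assume e: "e \<in> tails (Suc N) s h"
  show "e \<in> tails N s h \<union> ?B"
  proof (cases "Suc N \<in> set e")
    case False
    with e have "e \<in> tails N s h"
      by (fastforce simp: tails_def subset_iff le_Suc_eq)
    thus ?thesis ..
  next
    case True
    then obtain x e' where xe: "e = x # e'" by (cases e) auto
    with e True have x: "x = Suc N"
      by (auto simp: tails_def dest: bspec)
    with e xe have *: "altsum e' = int (Suc N - s)" "sum_list e' + Suc N = s + 2 * h"
      using assms by (auto simp: tails_def)
    with altsum_le_sum_list[of e'] assms have h: "Suc N - s \<le> h"
      by linarith
    have "e' \<in> tails (Suc N) (Suc N - s) (h - (Suc N - s))"
      using * h e assms unfolding xe by (auto simp: tails_def)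
    thus ?thesis using h xe x by auto
  qed
next
  fix e assume "e \<in> tails N s h \<union> ?B"
  thus "e \<in> tails (Suc N) s h"
    using assms by (fastforce simp: tails_def split: if_splits)
qed

lemma tails_fps_rec:
  assumes "s \<le> Suc N"
  shows "tails_fps (Suc N) s =
    tails_fps N s + fps_X ^ (Suc N - s) * (tails_fps (Suc N) (Suc N - s) :: 'a::comm_ring_1 fps)"
proof (rule fps_ext)
  fix h
  have disj: "tails N s h \<inter> (#) (Suc N) ` T = {}" for T
    by (auto simp: tails_def)
  show "fps_nth (tails_fps (Suc N) s :: 'a fps) h =
    fps_nth (tails_fps N s + fps_X ^ (Suc N - s) * tails_fps (Suc N) (Suc N - s)) h"
    using disj
    by (auto simp: tails_fps_def tails_rec[OF assms, of h] fps_X_power_mult_nth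
          card_Un_disjoint finite_tails card_image)
qed

lemma tails_fps_eq_0: "N < s \<Longrightarrow> tails_fps N s = 0"
  by (rule fps_ext) (simp add: tails_fps_def tails_empty)

lemma tails_fps_0_0: "tails_fps 0 0 = 1"
proof (rule fps_ext)
  fix h
  have "tails 0 0 h = (if h = 0 then {[]} else {})"
    by (auto simp: tails_def)
  thus "fps_nth (tails_fps 0 0) h = fps_nth 1 h"
    by (simp add: tails_fps_def)
qed

lemma qpoch_Suc: "qpoch q q (Suc k) = qpoch q q k * (1 - q ^ Suc k)"
  by (simp add: qpoch_def)

text \<open>
  The recurrence exchanges \<open>s\<close> and \<open>N + 1 - s\<close> on the right, so applying it twice returns to the
  series on the left, with a factor \<open>X\<close> to the power \<open>N + 1\<close>. Solving for this series leaves only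
  series of index \<open>N\<close>, as an induction on \<open>N\<close> requires.
\<close>

lemma tails_fps_rec_diff:
  assumes "s \<le> Suc N"
  shows "(1 - fps_X ^ Suc N) * tails_fps (Suc N) s =
    tails_fps N s + fps_X ^ (Suc N - s) * (tails_fps N (Suc N - s) :: 'a::comm_ring_1 fps)"
proof -
  let ?U = "tails_fps :: nat \<Rightarrow> nat \<Rightarrow> 'a fps"
  have 1: "?U (Suc N) s = ?U N s + fps_X ^ (Suc N - s) * ?U (Suc N) (Suc N - s)"
    by (rule tails_fps_rec[OF assms])
  have 2: "?U (Suc N) (Suc N - s) = ?U N (Suc N - s) + fps_X ^ s * ?U (Suc N) s"
    using tails_fps_rec[of "Suc N - s" N] assms by simp
  have 3: "(fps_X :: 'a fps) ^ Suc N = fps_X ^ (Suc N - s) * fps_X ^ s"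
    using assms by (simp only: power_add[symmetric]) simp
  show ?thesis using 1 2 unfolding 3 by (simp add: algebra_simps)
qed

text \<open>
  With \<open>t = N + 1 - s\<close>, the two summands of the previous recurrence, multiplied by
  \<open>(q;q)\<^sub>s (q;q)\<^sub>t\<close>, become \<open>1 - q\<^sup>t\<close> and \<open>q\<^sup>t (1 - q\<^sup>s)\<close> by the induction hypothesis. They add up to
  \<open>1 - q\<^bsup>s + t\<^esup>\<close>, which can be cancelled.
\<close>

lemma qpoch_tails_fps:
  assumes "s \<le> N"
  shows "qpoch fps_X fps_X s * qpoch fps_X fps_X (N - s) * tails_fps N s = (1 :: 'a::idom fps)"
  using assms
proof (induction N arbitrary: s)
  case 0
  thus ?case by (simp add: tails_fps_0_0 qpoch_def)
next
  case (Suc N)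
  let ?U = "tails_fps :: nat \<Rightarrow> nat \<Rightarrow> 'a fps" and ?P = "qpoch fps_X fps_X :: nat \<Rightarrow> 'a fps"
  define t where "t = Suc N - s"
  have st: "s + t = Suc N" using Suc.prems by (simp add: t_def)
  \<comment> \<open>For \<open>j = 0\<close> both sides vanish, as no tail with parts at most \<open>N\<close> has alternating sum \<open>N + 1\<close>.\<close>
  have half: "?P i * ?P j * ?U N i = 1 - fps_X ^ j" if "i + j = Suc N" for i j
  proof (cases j)
    case 0
    thus ?thesis using that by (simp add: tails_fps_eq_0)
  next
    case (Suc j')
    with that have "?P i * ?P j' * ?U N i = 1"
      using Suc.IH[of i] by auto
    hence "(?P i * ?P j' * ?U N i) * (1 - fps_X ^ Suc j') = 1 - fps_X ^ Suc j'"
      by simp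
    thus ?thesis unfolding Suc qpoch_Suc by (simp only: mult_ac)
  qed
  have "(1 - fps_X ^ Suc N) * (?P s * ?P t * ?U (Suc N) s)
      = ?P s * ?P t * ((1 - fps_X ^ Suc N) * ?U (Suc N) s)"
    by (simp add: mult_ac)
  also have "\<dots> = ?P s * ?P t * ?U N s + fps_X ^ t * (?P t * ?P s * ?U N t)"
    unfolding tails_fps_rec_diff[OF Suc.prems] t_def[symmetric] by (simp add: algebra_simps)
  also have "\<dots> = 1 - fps_X ^ t + fps_X ^ t * (1 - fps_X ^ s)"
    using half[of s t] half[of t s] st by (simp add: add.commute)
  also have "\<dots> = (1 - fps_X ^ Suc N) * 1"
    unfolding st[symmetric] by (simp add: algebra_simps power_add)
  finally have "(1 - fps_X ^ Suc N) * (?P s * ?P t * ?U (Suc N) s) = (1 - fps_X ^ Suc N) * 1" .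
  moreover have "fps_nth (1 - fps_X ^ Suc N :: 'a fps) 0 = 1"
    by simp
  hence "(1 - fps_X ^ Suc N :: 'a fps) \<noteq> 0"
    by (metis fps_zero_nth zero_neq_one)
  ultimately show ?case unfolding t_def by (simp only: mult_cancel_left) simp
qed

section \<open>Splitting a sequence into its run and its tail\<close>

text \<open>
  The condition that the last entry \<open>a + b\<close> of the run is at least the first entry of the tail
  is expressed as a bound on all entries of the tail, which is what \<open>tails\<close> asks for.
\<close>

lemma ab_seq_iff:
  "ab_seq a b ds \<longleftrightarrow> 1 \<le> b \<and> altsum ds = 0 \<and>
     (\<exists>e. ds = [a + 1..<a + 1 + b] @ e \<and> set e \<subseteq> {1..a + b} \<and> sorted_wrt (\<ge>) e)"
  (is "?L \<longleftrightarrow> ?R")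
proof
  assume L: ?L
  hence b: "1 \<le> b" "b \<le> length ds"
    and pos': "\<forall>i\<in>{1..length ds}. 1 \<le> ds ! (i - 1)"
    and run': "\<forall>i\<in>{1..b}. ds ! (i - 1) = a + i"
    and desc: "\<forall>i\<in>{b..<length ds}. ds ! (i - 1) \<ge> ds ! i"
    and alt: "altsum ds = 0"
    using neg_equal_0_iff_equal[of "altsum ds"] unfolding ab_seq_def altsum_conv_sum by blast+
  have pos: "1 \<le> ds ! i" if "i < length ds" for i
    using pos'[THEN bspec, of "Suc i"] that by simp
  have run: "ds ! i = a + 1 + i" if "i < b" for i
    using run'[THEN bspec, of "Suc i"] that by simp
  define e where "e = drop b ds"
  have "take b ds = [a + 1..<a + 1 + b]"
    using b run by (intro nth_equalityI) (auto simp del: upt_Suc)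
  hence ds: "ds = [a + 1..<a + 1 + b] @ e"
    by (metis append_take_drop_id e_def)
  \<comment> \<open>Starting one place before the tail includes the comparison of \<open>a + b\<close> with the tail.\<close>
  have "drop (b - 1) ds = ds ! (b - 1) # drop b ds"
    using b by (metis Cons_nth_drop_Suc Suc_diff_1 Suc_le_eq diff_less less_le_trans zero_less_one)
  hence de: "drop (b - 1) ds = (a + b) # e"
    using b run[of "b - 1"] by (simp add: e_def)
  have "sorted_wrt (\<ge>) (drop (b - 1) ds)"
    using b desc[THEN bspec, of "b + i" for i]
    by (subst sorted_wrt_iff_nth_Suc_transp) (auto simp: transp_def)
  hence srt: "sorted_wrt (\<ge>) ((a + b) # e)" unfolding de .
  have "x \<ge> 1" if "x \<in> set e" for x
    using that pos in_set_dropD[of x b ds] unfolding e_def by (metis in_set_conv_nth)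
  with srt ds alt b show ?R by auto
next
  assume ?R
  then obtain e where b: "1 \<le> b" and ds: "ds = [a + 1..<a + 1 + b] @ e"
    and e: "set e \<subseteq> {1..a + b}" "sorted_wrt (\<ge>) e" and alt: "altsum ds = 0" by blast
  have len: "length ds = b + length e" using ds by simp
  have run: "ds ! i = a + 1 + i" if "i < b" for i
    using that by (simp add: ds nth_append del: upt_Suc)
  have tail: "ds ! i = e ! (i - b)" if "b \<le> i" for i
    using that by (simp add: ds nth_append del: upt_Suc)
  have e_bd: "1 \<le> e ! i \<and> e ! i \<le> a + b" if "i < length e" for i
    using subsetD[OF e(1) nth_mem[OF that]] by simp
  have "ds ! (i - 1) \<ge> ds ! i" if i: "b \<le> i" "i < length ds" for i
  proof (cases "i = b")
    case True
    thus ?thesis using run[of "b - 1"] b tail[of b] e_bd[of 0] i len by simp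
  next
    case False
    with i have "e ! (i - 1 - b) \<ge> e ! (i - b)"
      using e(2) len by (intro sorted_wrt_nth_less[of "(\<ge>)" e]) auto
    thus ?thesis using tail[of i] tail[of "i - 1"] i False by simp
  qed
  moreover have "1 \<le> ds ! i" if "i < length ds" for i
    using that run[of i] tail[of i] e_bd[of "i - b"] len by (cases "i < b") auto
  ultimately show ?L
    unfolding ab_seq_def altsum_conv_sum using b len alt run by auto
qed

definition count_S :: "nat \<Rightarrow> nat \<Rightarrow> nat \<Rightarrow> nat" where
  "count_S a b n = card {ds \<in> S_ab a b. sum_list ds = 2 * n}"

text \<open>
  Prepending the run is a bijection from tails to \<open>(a, b)\<close>-sequences. The number \<open>s\<close> is the
  alternating sum of the tail that cancels that of the run, where the sign accounts for the
  position at which the tail starts. The number \<open>m\<close> is half the smallest weight of a sequence, since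
  a tail of alternating sum \<open>s\<close> has weight at least \<open>s\<close>.
\<close>

lemma count_S_eq_tails_fps:
  assumes b: "1 \<le> b"
    and alt: "altsum [a + 1..<a + 1 + b] = - ((- 1) ^ b * int s)"
    and sum: "sum_list [a + 1..<a + 1 + b] + s = 2 * m"
  shows "of_nat (count_S a b n) = fps_nth (fps_X ^ m * (tails_fps (a + b) s :: 'a::comm_ring_1 fps)) n"
proof -
  let ?run = "[a + 1..<a + 1 + b]"
  have alt_iff: "altsum (?run @ e) = 0 \<longleftrightarrow> altsum e = int s" for e
  proof -
    have "altsum (?run @ e) = (- 1) ^ b * (altsum e - int s)"
      unfolding altsum_append alt length_upt by (simp add: right_diff_distrib)
    thus ?thesis by (simp del: upt_Suc)
  qed
  have eq: "{ds \<in> S_ab a b. sum_list ds = 2 * n} =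
    (if m \<le> n then (@) ?run ` tails (a + b) s (n - m) else {})" (is "?A = ?B")
  proof (intro equalityI subsetI)
    fix ds assume "ds \<in> ?A"
    then obtain e where ds: "ds = ?run @ e" and e: "set e \<subseteq> {1..a + b}" "sorted_wrt (\<ge>) e"
      "altsum e = int s" and n: "sum_list ?run + sum_list e = 2 * n"
      unfolding S_ab_def ab_seq_iff using alt_iff by auto
    have "s \<le> sum_list e" using altsum_le_sum_list[of e] e(3) by simp
    with n sum have mn: "m \<le> n" and "sum_list e = s + 2 * (n - m)" by linarith+
    with e have "e \<in> tails (a + b) s (n - m)" by (auto simp: tails_def)
    with mn ds show "ds \<in> ?B" by auto
  next
    fix ds assume "ds \<in> ?B"
    then obtain e where mn: "m \<le> n" and ds: "ds = ?run @ e" and e: "e \<in> tails (a + b) s (n - m)"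
      by (auto split: if_splits)
    from e mn sum have "sum_list ds = 2 * n"
      unfolding ds sum_list_append tails_def by auto
    moreover have "ab_seq a b ds"
      unfolding ab_seq_iff using b e alt_iff[of e] ds by (auto simp: tails_def)
    ultimately show "ds \<in> ?A" by (simp add: S_ab_def)
  qed
  show ?thesis
    unfolding count_S_def eq
    by (simp add: fps_X_power_mult_nth tails_fps_def card_image inj_on_def del: upt_Suc)
qed

lemma sum_list_run: "2 * sum_list [a + 1..<a + 1 + b] = b * (2 * a + b + 1)"
proof (induction b)
  case (Suc b)
  have "[a + 1..<a + 1 + Suc b] = [a + 1..<a + 1 + b] @ [a + 1 + b]" by simp
  thus ?case using Suc by (simp add: algebra_simps del: upt_Suc)
qed simp

lemma count_S_even:
  assumes "1 \<le> k"
  shows "of_nat (count_S a (2 * k) n) =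
    fps_nth (fps_X ^ (k * (a + k) + k) * (tails_fps (a + 2 * k) k :: 'a::comm_ring_1 fps)) n"
proof (rule count_S_eq_tails_fps)
  show "sum_list [a + 1..<a + 1 + 2 * k] + k = 2 * (k * (a + k) + k)"
    using sum_list_run[of a "2 * k"] by (simp add: algebra_simps del: upt_Suc)
  show "altsum [a + 1..<a + 1 + 2 * k] = - ((- 1) ^ (2 * k) * int k)"
    by (simp only: altsum_even_run) simp
qed (use assms in auto)

lemma count_S_odd:
  assumes "1 \<le> k"
  shows "of_nat (count_S a (2 * k - 1) n) =
    fps_nth (fps_X ^ (k * (a + k)) * (tails_fps (a + (2 * k - 1)) (a + k) :: 'a::comm_ring_1 fps)) n"
proof (rule count_S_eq_tails_fps)
  obtain j where k: "k = Suc j" using assms by (cases k) auto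
  show "sum_list [a + 1..<a + 1 + (2 * k - 1)] + (a + k) = 2 * (k * (a + k))"
    using sum_list_run[of a "2 * k - 1"] unfolding k by (simp add: algebra_simps del: upt_Suc)
  show "altsum [a + 1..<a + 1 + (2 * k - 1)] = - ((- 1) ^ (2 * k - 1) * int (a + k))"
    using altsum_odd_run[of a j] unfolding k by (simp add: algebra_simps del: upt_Suc)
qed (use assms in auto)

section \<open>The two sides of the identity\<close>

definition rhs_term :: "nat \<Rightarrow> nat \<Rightarrow> fps_xyq" where
  "rhs_term i k = (1 + (var_y - 1) * var_q ^ k) * var_y ^ (2 * k - 1) * var_q ^ (k * (i + k))
                   / (qpoch var_q var_q k * qpoch var_q var_q (i + k))"

text \<open>
  By \<open>qpoch_tails_fps\<close>, division by \<open>(q;q)\<^sub>k (q;q)\<^sub>i\<^sub>+\<^sub>k\<close> is multiplication by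
  \<open>U = tails_fps (i + 2 * k) k\<close>, and the series \<open>V\<close> of the sequences with \<open>b = 2 k - 1\<close> is
  \<open>(1 - q\<^sup>k) U\<close>, as \<open>(q;q)\<^sub>k = (q;q)\<^sub>k\<^sub>-\<^sub>1 (1 - q\<^sup>k)\<close>. So the splitting
  \<open>1 + (y - 1) q\<^sup>k = (1 - q\<^sup>k) + y q\<^sup>k\<close> separates the odd from the even \<open>b\<close>.
\<close>

lemma rhs_term_eq:
  assumes "1 \<le> k"
  shows "rhs_term i k =
    var_y ^ (2 * k - 1) * (var_q ^ (k * (i + k)) * tails_fps (i + (2 * k - 1)) (i + k)) +
    var_y ^ (2 * k) * (var_q ^ (k * (i + k) + k) * tails_fps (i + 2 * k) k)"
proof -
  obtain j where k: "k = Suc j" using assms by (cases k) auto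
  let ?P = "qpoch var_q var_q" and ?q = var_q and ?y = var_y
  define Q U V where "Q = var_q ^ k"
    and "U = (tails_fps (i + 2 * k) k :: fps_xyq)"
    and "V = (tails_fps (i + (2 * k - 1)) (i + k) :: fps_xyq)"
  have U: "?P k * ?P (i + k) * U = 1"
    using qpoch_tails_fps[of k "i + 2 * k"] by (simp add: var_q_def U_def mult_2 add.assoc[symmetric])
  have V: "?P (i + k) * ?P j * V = 1"
    using qpoch_tails_fps[of "i + k" "i + (2 * k - 1)"] by (simp add: var_q_def V_def k)
  have P: "?P k = ?P j * (1 - Q)" unfolding k Q_def qpoch_Suc ..
  have V_eq: "V = (1 - Q) * U"
  proof -
    have "V = (?P k * ?P (i + k) * U) * V" using U by simp
    also have "\<dots> = (?P (i + k) * ?P j * V) * ((1 - Q) * U)" unfolding P by (simp only: mult_ac)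
    finally show ?thesis using V by simp
  qed
  have inv: "inverse (?P k * ?P (i + k)) = U"
  proof -
    let ?D = "?P k * ?P (i + k)"
    have "inverse ?D = (?D * U) * inverse ?D" using U by simp
    also have "\<dots> = (?D * inverse ?D) * U" by (simp only: mult_ac)
    finally show ?thesis using divide_qpoch(1)[of k "i + k"] by simp
  qed
  have y: "?y ^ (2 * k) = ?y * ?y ^ (2 * k - 1)" by (simp add: k)
  show ?thesis
    unfolding rhs_term_def divide_qpoch(2) inv U_def[symmetric] V_def[symmetric] V_eq y power_add Q_def[symmetric]
    by (simp add: algebra_simps)
qed

lemma nth_var_y_power_mult: "fps_nth (var_y ^ b * f) n = fps_X ^ b * fps_nth f n"
  unfolding var_y_def fps_const_power by simp

lemma nth_var_x_power_mult: "fps_nth (var_x ^ a * f) n = fps_const fps_X ^ a * fps_nth f n"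
  unfolding var_x_def fps_const_power by simp

lemma nth_rhs_term:
  assumes "1 \<le> k"
  shows "fps_nth (rhs_term i k) n =
    fps_X ^ (2 * k - 1) * of_nat (count_S i (2 * k - 1) n) + fps_X ^ (2 * k) * of_nat (count_S i (2 * k) n)"
  by (simp only: rhs_term_eq[OF assms] fps_add_nth nth_var_y_power_mult count_S_even[OF assms]
        count_S_odd[OF assms] var_q_def)

text \<open>
  These bounds make all sums finite in each power of \<open>q\<close>. They are crude but sufficient: the weight
  bounds the length of the sequence, hence \<open>b\<close>, and its first entry \<open>a + 1\<close>.
\<close>

lemma S_ab_bounds:
  assumes "ds \<in> S_ab a b"
  shows "1 \<le> b" "b \<le> sum_list ds" "a < sum_list ds" "0 \<notin> set ds"
proof -
  from assms obtain e where b: "1 \<le> b" and ds: "ds = [a + 1..<a + 1 + b] @ e"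
    and e: "set e \<subseteq> {1..a + b}"
    by (auto simp: S_ab_def ab_seq_iff)
  show "1 \<le> b" by fact
  show 0: "0 \<notin> set ds" using e unfolding ds by auto
  show "b \<le> sum_list ds" using length_le_sum_list[OF 0] ds by simp
  have "a + 1 \<in> set ds" using b unfolding ds by (simp del: upt_Suc)
  thus "a < sum_list ds" using member_le_sum_list[of "a + 1" ds] by simp
qed

lemma count_S_eq_0: "2 * n < b \<or> 2 * n \<le> a \<Longrightarrow> count_S a b n = 0"
proof -
  assume "2 * n < b \<or> 2 * n \<le> a"
  hence "{ds \<in> S_ab a b. sum_list ds = 2 * n} = {}"
    using S_ab_bounds(2,3)[of _ a b] by fastforce
  thus ?thesis by (simp only: count_S_def card.empty)
qed

lemma nth_rhs_term_eq_0:
  assumes "1 \<le> k" "2 * n < k \<or> 2 * n \<le> i"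
  shows "fps_nth (rhs_term i k) n = 0"
proof -
  have "count_S i (2 * k - 1) n = 0" "count_S i (2 * k) n = 0"
    using assms by (auto intro!: count_S_eq_0)
  thus ?thesis using nth_rhs_term[OF assms(1), of i n] by simp
qed

text \<open>
  The bound \<open>2 n\<close> on \<open>k\<close> is safe: sequences of weight \<open>2 n\<close> have \<open>b \<le> 2 n\<close>, and \<open>k\<close> is at most
  \<open>2 k - 1\<close>. The same bound serves for \<open>i\<close> in the outer sum.
\<close>

definition rhs_sum :: "nat \<Rightarrow> fps_xyq" where
  "rhs_sum i = Abs_fps (\<lambda>n. \<Sum>k\<in>{1..2 * n}. fps_nth (rhs_term i k) n)"

lemma has_sum_rhs_term: "(rhs_term i has_sum rhs_sum i) {1..}"
  by (rule has_sum_fpsI[where F = "\<lambda>n. {1..2 * n}"])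
     (auto simp: rhs_sum_def intro!: nth_rhs_term_eq_0)

lemma sum_pairs_consecutive:
  fixes g :: "nat \<Rightarrow> 'a::comm_monoid_add"
  shows "(\<Sum>k\<in>{1..m}. g (2 * k - 1) + g (2 * k)) = (\<Sum>b\<in>{1..2 * m}. g b)"
  by (induction m) (simp_all add: add.assoc)

lemma nth_rhs_sum:
  "fps_nth (rhs_sum i) n = (\<Sum>b\<in>{1..4 * n}. fps_X ^ b * of_nat (count_S i b n))"
proof -
  have "fps_nth (rhs_sum i) n = (\<Sum>k\<in>{1..2 * n}. fps_X ^ (2 * k - 1) * of_nat (count_S i (2 * k - 1) n)
      + fps_X ^ (2 * k) * of_nat (count_S i (2 * k) n))"
    by (simp add: rhs_sum_def nth_rhs_term del: One_nat_def)
  also have "\<dots> = (\<Sum>b\<in>{1..2 * (2 * n)}. fps_X ^ b * of_nat (count_S i b n))"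
    by (rule sum_pairs_consecutive)
  finally show ?thesis by simp
qed

definition rhs_total :: fps_xyq where
  "rhs_total = Abs_fps (\<lambda>n. \<Sum>i\<in>{0..2 * n}. fps_nth (var_x ^ i * rhs_sum i) n)"

lemma has_sum_rhs_sum: "((\<lambda>i. var_x ^ i * rhs_sum i) has_sum rhs_total) {0..}"
proof (rule has_sum_fpsI[where F = "\<lambda>n. {0..2 * n}"])
  fix n i :: nat assume "i \<notin> {0..2 * n}"
  thus "fps_nth (var_x ^ i * rhs_sum i) n = 0"
    by (simp add: nth_var_x_power_mult nth_rhs_sum count_S_eq_0)
qed (auto simp: rhs_total_def)

definition lhs_term :: "nat list \<Rightarrow> fps_xyq" where
  "lhs_term ds = var_x ^ a_of ds * var_y ^ b_of ds * var_q ^ (sum_list ds div 2)"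

lemma nth_lhs_term:
  assumes "ds \<in> S_all"
  shows "fps_nth (lhs_term ds) n =
    (if sum_list ds = 2 * n then fps_const fps_X ^ a_of ds * fps_X ^ b_of ds else 0)"
proof -
  have "sum_list ds div 2 = n \<longleftrightarrow> sum_list ds = 2 * n"
    using even_sum_list_S_all[OF assms] by auto
  thus ?thesis
    unfolding lhs_term_def mult.assoc nth_var_x_power_mult nth_var_y_power_mult var_q_def
    by (auto simp: fps_X_power_nth)
qed

lemma S_all_cases:
  assumes "ds \<in> S_all" "ds \<noteq> []"
  shows "ds \<in> S_ab (a_of ds) (b_of ds)"
  using assms a_of_eq b_of_eq by (fastforce simp: S_all_def)

lemma finite_S_all_sum: "finite {ds \<in> S_all. sum_list ds = n}"
  by (rule finite_subset[OF _ finite_positive_lists_sum[of n]])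
     (auto simp: S_all_def dest: S_ab_bounds(4))

text \<open>
  The coefficient of a power of \<open>q\<close> is the same finite sum on both sides once the nonempty sequences
  are grouped by the pair \<open>(a, b)\<close>; the empty sequence accounts for the summand \<open>1\<close>.
\<close>

lemma sum_S_all:
  "(\<Sum>ds\<in>{ds \<in> S_all. sum_list ds = 2 * n}. fps_nth (lhs_term ds) n) = fps_nth (1 + rhs_total) n"
proof -
  let ?A = "{ds \<in> S_all. sum_list ds = 2 * n}"
  let ?B = "{ds \<in> S_all - {[]}. sum_list ds = 2 * n}"
  \<comment> \<open>The range up to \<open>4 n\<close> comes from \<open>k \<le> 2 n\<close> and \<open>b = 2 k\<close>, as in \<open>nth_rhs_sum\<close>.\<close>
  let ?T = "{0..2 * n} \<times> {1..4 * n}"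
  let ?w = "\<lambda>(a, b). fps_const fps_X ^ a * fps_X ^ b :: rat fps fps"
  have fin: "finite ?B" by (rule finite_subset[OF _ finite_S_all_sum[of "2 * n"]]) auto
  have img: "(\<lambda>ds. (a_of ds, b_of ds)) ` ?B \<subseteq> ?T"
  proof (rule image_subsetI)
    fix ds assume "ds \<in> ?B"
    with S_ab_bounds(1-3)[OF S_all_cases, of ds] show "(a_of ds, b_of ds) \<in> ?T" by simp
  qed
  have fiber: "{ds \<in> ?B. (a_of ds, b_of ds) = (a, b)} = {ds \<in> S_ab a b. sum_list ds = 2 * n}"
    if "1 \<le> b" for a b
  proof -
    have "ds \<in> S_all \<and> ds \<noteq> [] \<and> a_of ds = a \<and> b_of ds = b" if "ds \<in> S_ab a b" for ds
      using that \<open>1 \<le> b\<close> S_ab_bounds(1,2)[OF that] a_of_eq[OF that] b_of_eq[OF that]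
      by (auto simp: S_all_def)
    thus ?thesis using S_all_cases by auto
  qed
  have "(\<Sum>ds\<in>?B. fps_nth (lhs_term ds) n) = (\<Sum>ds\<in>?B. ?w (a_of ds, b_of ds))"
    by (intro sum.cong) (auto simp: nth_lhs_term)
  also have "\<dots> = (\<Sum>p\<in>?T. \<Sum>ds\<in>{ds \<in> ?B. (a_of ds, b_of ds) = p}. ?w (a_of ds, b_of ds))"
    by (rule sum.group[symmetric]) (use fin img in auto)
  also have "\<dots> = (\<Sum>p\<in>?T. ?w p * of_nat (count_S (fst p) (snd p) n))"
  proof (rule sum.cong[OF refl])
    fix p assume p: "p \<in> ?T"
    let ?Bp = "{ds \<in> ?B. (a_of ds, b_of ds) = p}"
    have Bp: "?Bp = {ds \<in> S_ab (fst p) (snd p). sum_list ds = 2 * n}"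
      using fiber[of "snd p" "fst p"] p by auto
    have "(\<Sum>ds\<in>?Bp. ?w (a_of ds, b_of ds)) = (\<Sum>ds\<in>?Bp. ?w p)"
      by (intro sum.cong) auto
    also have "\<dots> = ?w p * of_nat (card ?Bp)"
      by (simp only: sum_constant mult.commute)
    finally show "(\<Sum>ds\<in>?Bp. ?w (a_of ds, b_of ds)) = ?w p * of_nat (count_S (fst p) (snd p) n)"
      unfolding count_S_def Bp .
  qed
  also have "\<dots> = (\<Sum>a\<in>{0..2 * n}. \<Sum>b\<in>{1..4 * n}. ?w (a, b) * of_nat (count_S a b n))"
    by (simp add: sum.cartesian_product case_prod_beta)
  also have "\<dots> = fps_nth rhs_total n"
    by (simp add: rhs_total_def nth_var_x_power_mult nth_rhs_sum sum_distrib_left mult.assoc)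
  finally have B: "(\<Sum>ds\<in>?B. fps_nth (lhs_term ds) n) = fps_nth rhs_total n" .
  have A: "?A = (if n = 0 then insert [] ?B else ?B)"
    by (auto simp: S_all_def)
  have nil: "lhs_term [] = 1" by (simp add: lhs_term_def a_of_def b_of_def)
  have ins: "(\<Sum>ds\<in>insert [] ?B. fps_nth (lhs_term ds) n) =
      fps_nth (lhs_term []) n + (\<Sum>ds\<in>?B. fps_nth (lhs_term ds) n)"
    by (rule sum.insert) (use fin in auto)
  show ?thesis
    unfolding A fps_add_nth B[symmetric] using ins nil
    by (cases "n = 0") (simp_all only: if_True if_False simp_thms fps_one_nth add_0_left)
qed

lemma has_sum_lhs_term: "(lhs_term has_sum (1 + rhs_total)) S_all"
  by (rule has_sum_fpsI[where F = "\<lambda>n. {ds \<in> S_all. sum_list ds = 2 * n}", OF finite_S_all_sum _ _ sum_S_all[symmetric]])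
     (auto simp: nth_lhs_term)

theorem theorem2p2:
  shows
    "let x = var_x; y = var_y; q = var_q;
         L = (\<lambda>\<Delta>. x ^ a_of \<Delta> * y ^ b_of \<Delta> * q ^ (sum_list \<Delta> div 2));
         R = (\<lambda>i k. (1 + (y - 1) * q ^ k) * y ^ (2 * k - 1) * q ^ (k * (i + k))
                      / (qpoch q q k * qpoch q q (i + k)))
     in L summable_on S_all \<and>
        (\<forall>i. R i summable_on {1..}) \<and>
        (\<lambda>i. x ^ i * (\<Sum>\<^sub>\<infinity>k\<in>{1..}. R i k)) summable_on {0..} \<and>
        (\<Sum>\<^sub>\<infinity>\<Delta>\<in>S_all. L \<Delta>) =
          1 + (\<Sum>\<^sub>\<infinity>i\<in>{0..}. x ^ i * (\<Sum>\<^sub>\<infinity>k\<in>{1..}. R i k))"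
  unfolding Let_def rhs_term_def[symmetric] lhs_term_def[symmetric] infsumI[OF has_sum_rhs_term]
    infsumI[OF has_sum_rhs_sum] infsumI[OF has_sum_lhs_term]
  using has_sum_lhs_term has_sum_rhs_term has_sum_rhs_sum
  by (intro conjI allI has_sum_imp_summable refl)

end
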